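(* Let $d\ge2$, let $\Omega\subseteq\mathbb{R}^d$ be an open, simply connected, bounded region with $C^2$ boundary, and let $B$ be the open unit ball in $\mathbb{R}^d$. Let $A(\mathbf{s})=[a_{i,j}(\mathbf{s})]_{i,j=1}^d$ be a symmetric matrix function with entries $a_{i,j}\in C^2(\overline{\Omega})$, satisfying $\xi^{\mathrm T}A(\mathbf{s})\xi\ge c_0\,\xi^{\mathrm T}\xi$ for all $\mathbf{s}\in\overline\Omega$, $\xi\in\mathbb{R}^d$, with a constant $c_0>0$. Let $\Phi:\overline{B}\to\overline{\Omega}$ be a twice-differentiable one-to-one and onto mapping whose Jacobian matrix $J$ satisfies $\min_{\mathbf{x}\in\overline{B}}|\det J(\mathbf{x})|>0$ and $\det J(\mathbf{x})>0$ for all $\mathbf{x}\in\overline B$. Let $$\widetilde A(\mathbf{x})=K(\Phi(\mathbf{x}))\,A(\Phi(\mathbf{x}))\,K(\Phi(\mathbf{x}))^{\mathrm T},\quad\mathbf{x}\in\overline B.$$ Then $\widetilde A$ satisfies the strong ellipticity condition $$\xi^{\mathrm T}\widetilde A(\mathbf{x})\xi\ge\widetilde c_0\,\xi^{\mathrm T}\xi,\quad \mathbf{x}\in\overline B,\ \xi\in\mathbb{R}^d,$$ with $$\widetilde c_0=c_0\lambda_*>0,\qquad \lambda_*=\min_{\mathbf{x}\in\overline B}\lambda_{\min}(\mathbf{x}),$$ where $\lambda_{\min}(\mathbf{x})$ is the smallest eigenvalue of $K(\Phi(\mathbf{x}))^{\mathrm T}K(\Phi(\mathbf{x}))$ (which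 equals the reciprocal of the largest eigenvalue of $J(\mathbf{x})^{\mathrm T}J(\mathbf{x})$).
   Context: Write $\Phi=(\varphi_1,\dots,\varphi_d)$. $J(\mathbf{x})=(D\Phi)(\mathbf{x})=[\partial\varphi_i(\mathbf{x})/\partial x_j]_{i,j=1}^d$ is the Jacobian matrix of $\Phi$ on $\overline B$, $\Psi=\Phi^{-1}:\overline\Omega\to\overline B$, and $K(\mathbf{s})=(D\Psi)(\mathbf{s})$ is the Jacobian matrix of $\Psi$ on $\overline\Omega$; thus $K(\Phi(\mathbf{x}))=J(\mathbf{x})^{-1}$. *)

theory Defs
  imports "HOL-Analysis.Analysis"
begin

(* The class C^2(closure U) for an open set U: f is C^2 in U, and f, its gradient g and its
   Hessian H extend continuously to the closure of U. For U = UNIV this is plain C^2. *)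
definition C2_closure :: "(real ^ 'n) set \<Rightarrow> (real ^ 'n \<Rightarrow> real) \<Rightarrow> bool" where
  "C2_closure U f \<longleftrightarrow>
     (\<exists>(g :: real ^ 'n \<Rightarrow> real ^ 'n) (H :: real ^ 'n \<Rightarrow> real ^ 'n ^ 'n).
        continuous_on (closure U) f \<and> continuous_on (closure U) g \<and> continuous_on (closure U) H \<and>
        (\<forall>x\<in>U. GDERIV f x :> g x \<and> (g has_derivative (\<lambda>h. H x *v h)) (at x)))"

(* Near each boundary point, U is, in suitable orthonormal coordinates, the region strictly above
   the graph of a C^2 function. The unit vector u is the vertical direction; x - (x \<bullet> u) u is the
   horizontal part of x, so only the values of \<gamma> on the hyperplane orthogonal to u matter. *)
definition C2_boundary :: "(real ^ 'n) set \<Rightarrow> bool" where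
  "C2_boundary U \<longleftrightarrow>
     (\<forall>p\<in>frontier U. \<exists>r>0. \<exists>u \<gamma>. norm u = 1 \<and> C2_closure UNIV \<gamma> \<and>
        U \<inter> ball p r = {x \<in> ball p r. \<gamma> (x - (x \<bullet> u) *\<^sub>R u) < x \<bullet> u})"

(* On a set that is not open, derivatives are taken relative to the set. *)
definition twice_differentiable_on ::
    "(real ^ 'n \<Rightarrow> real ^ 'm) \<Rightarrow> (real ^ 'n) set \<Rightarrow> bool" where
  "twice_differentiable_on f S \<longleftrightarrow>
     f differentiable_on S \<and> (\<lambda>x. jacobian f (at x within S)) differentiable_on S"

definition eigenvalues :: "real ^ 'n ^ 'n \<Rightarrow> real set" where
  "eigenvalues M = {\<mu>. \<exists>v. v \<noteq> 0 \<and> M *v v = \<mu> *\<^sub>R v}"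

definition is_min :: "real set \<Rightarrow> real \<Rightarrow> bool" where
  "is_min S m \<longleftrightarrow> m \<in> S \<and> (\<forall>y\<in>S. m \<le> y)"

definition is_max :: "real set \<Rightarrow> real \<Rightarrow> bool" where
  "is_max S m \<longleftrightarrow> m \<in> S \<and> (\<forall>y\<in>S. y \<le> m)"

end

theory Submission
  imports Defs
begin

text \<open>
  Since \<open>\<Psi> \<circ> \<Phi>\<close> is the identity on the closed ball, the chain rule gives \<open>K (\<Phi> x) ** J x = 1\<close>, at
  boundary points too: derivatives within a convex set with interior points are unique, and \<open>\<Psi>\<close> is
  differentiable within the image of \<open>\<Phi>\<close> because \<open>J x\<close> is invertible. So only the linear algebra of
  an invertible matrix \<open>M\<close> remains. The largest eigenvalue of \<open>transpose M ** M\<close> is the maximum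
  of the squared norm of \<open>M *v v\<close> over unit vectors \<open>v\<close>, and maximizing jointly over \<open>x\<close> and \<open>v\<close>
  produces a point of the ball where this eigenvalue is largest.
\<close>

section \<open>Derivatives within convex sets\<close>

text \<open>Restricting \<open>f\<close> to the segment from \<open>x\<close> to a point
  \<open>y\<close> of \<open>S\<close> shows that both derivatives agree on \<open>y - x\<close>.
  Differences of such vectors, with \<open>y\<close> ranging over a ball inside \<open>S\<close>,
  point in every direction, so linearity gives agreement everywhere.\<close>

lemma has_derivative_unique_within_convex:
  fixes f :: "'a::euclidean_space \<Rightarrow> 'b::real_normed_vector"
  assumes f': "(f has_derivative f') (at x within S)"
    and f'': "(f has_derivative f'') (at x within S)"
    and S: "convex S" "interior S \<noteq> {}" and x: "x \<in> S"
  shows "f' = f''"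
proof -
  interpret f': bounded_linear f' using f' by (rule has_derivative_bounded_linear)
  interpret f'': bounded_linear f'' using f'' by (rule has_derivative_bounded_linear)
  have seg: "f' (y - x) = f'' (y - x)" if y: "y \<in> S" for y
  proof -
    define p where "p t = x + t *\<^sub>R (y - x)" for t :: real
    have p: "(p has_derivative (\<lambda>t. t *\<^sub>R (y - x))) (at 0 within {0..1})"
      unfolding p_def by (auto intro!: derivative_eq_intros)
    have "p ` {0..1} \<subseteq> S"
    proof clarify
      fix t :: real assume "t \<in> {0..1}"
      then have "(1 - t) *\<^sub>R x + t *\<^sub>R y \<in> S"
        using convexD_alt[OF S(1) x y] by simp
      moreover have "p t = (1 - t) *\<^sub>R x + t *\<^sub>R y"
        by (simp add: p_def algebra_simps)
      ultimately show "p t \<in> S" by simp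
    qed
    then have comp: "(f \<circ> p has_derivative g \<circ> (\<lambda>t. t *\<^sub>R (y - x))) (at 0 within {0..1})"
      if "(f has_derivative g) (at x within S)" for g
      using that by (intro diff_chain_within[OF p]) (auto simp: p_def intro: has_derivative_subset)
    \<comment> \<open>Uniqueness within a set needs arbitrarily small nonzero steps along each basis
      vector that stay in the set. Here \<open>i\<close> is 1, and the cap at 1 keeps the step
      inside \<open>{0..1}\<close>.\<close>
    have "\<exists>d. 0 < \<bar>d\<bar> \<and> \<bar>d\<bar> < e \<and> 0 + d *\<^sub>R i \<in> {0..1}" if "i \<in> Basis" "e > 0" for i e :: real
      using that by (intro exI[of _ "min (e/2) 1"]) auto
    then have "f' \<circ> (\<lambda>t. t *\<^sub>R (y - x)) = f'' \<circ> (\<lambda>t. t *\<^sub>R (y - x))"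
      by (rule frechet_derivative_unique_within[OF comp[OF f'] comp[OF f'']])
    from fun_cong[OF this, of 1] show ?thesis by simp
  qed
  obtain c e where e: "e > 0" "ball c e \<subseteq> S"
    using S(2) by (meson ex_in_conv mem_interior)
  have "f' h = f'' h" for h
  proof (cases "h = 0")
    case False
    \<comment> \<open>This factor puts \<open>c + k *\<^sub>R h\<close> at distance
      \<open>e / 2\<close> from \<open>c\<close>, hence in \<open>S\<close>; then
      \<open>k *\<^sub>R h\<close> is a difference of two vectors covered by
      \<open>seg\<close>.\<close>
    define k where "k = e / (2 * norm h)"
    have k: "k > 0" using False e by (simp add: k_def)
    have "c + k *\<^sub>R h \<in> S" "c \<in> S"
      using e False by (auto simp: k_def dist_norm intro!: subsetD[OF e(2)])
    then have "f' ((c + k *\<^sub>R h - x) - (c - x)) = f'' ((c + k *\<^sub>R h - x) - (c - x))"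
      unfolding f'.diff[of "c + k *\<^sub>R h - x"] f''.diff[of "c + k *\<^sub>R h - x"] by (simp only: seg)
    then have "f' (k *\<^sub>R h) = f'' (k *\<^sub>R h)" by simp
    then show ?thesis using k by (simp add: f'.scaleR f''.scaleR)
  qed (simp add: f'.zero f''.zero)
  then show ?thesis by auto
qed

lemma jacobian_inv_into:
  fixes f :: "real ^ 'n \<Rightarrow> real ^ 'n"
  assumes f: "f differentiable_on S" "inj_on f S"
    and S: "compact S" "convex S" "interior S \<noteq> {}" and x: "x \<in> S"
    and det: "det (jacobian f (at x within S)) \<noteq> 0"
  shows "jacobian (inv_into S f) (at (f x) within f ` S) ** jacobian f (at x within S) = mat 1"
proof -
  let ?J = "jacobian f (at x within S)" and ?K = "jacobian (inv_into S f) (at (f x) within f ` S)"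
  have J: "(f has_derivative (*v) ?J) (at x within S)"
    using f(1) x by (simp add: differentiable_on_def flip: jacobian_works)
  obtain L where L: "L ** ?J = mat 1"
    using det by (meson invertible_def invertible_det_nz)
  have "continuous_on (f ` S) (inv_into S f)"
    using f S(1) by (intro continuous_on_inv differentiable_imp_continuous_on) auto
  then have "(inv_into S f has_derivative (*v) L) (at (f x) within f ` S)"
    using x f(2) L by (intro has_derivative_inverse_within[OF J])
      (auto simp: continuous_on_eq_continuous_within fun_eq_iff matrix_vector_mul_assoc)
  then have "(inv_into S f has_derivative (*v) ?K) (at (f x) within f ` S)"
    using differentiableI jacobian_works by blast
  from diff_chain_within[OF J this]
  have "((\<lambda>y. y) has_derivative (*v) ?K \<circ> (*v) ?J) (at x within S)"
    by (rule has_derivative_transform[OF x, rotated]) (simp add: f(2))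
  then have "(*v) ?K \<circ> (*v) ?J = (\<lambda>h. h)"
    by (rule has_derivative_unique_within_convex[OF _ has_derivative_ident S(2,3) x])
  then show ?thesis
    by (simp add: matrix_eq fun_eq_iff matrix_vector_mul_assoc)
qed

section \<open>Extreme eigenvalues\<close>

lemma inner_transpose_matrix:
  fixes M :: "real ^ 'n ^ 'm"
  shows "x \<bullet> (M *v y) = (transpose M *v x) \<bullet> y"
  by (simp add: dot_lmul_matrix)

lemma inner_gram_matrix:
  fixes M :: "real ^ 'n ^ 'm"
  shows "v \<bullet> ((transpose M ** M) *v v) = (norm (M *v v))\<^sup>2"
proof -
  have "v \<bullet> ((transpose M ** M) *v v) = v \<bullet> (transpose M *v (M *v v))"
    by (simp only: matrix_vector_mul_assoc)
  also have "\<dots> = (M *v v) \<bullet> (M *v v)"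
    by (subst inner_transpose_matrix) (simp only: transpose_transpose)
  finally show ?thesis by (simp add: power2_norm_eq_inner)
qed

text \<open>The form is minimal at \<open>v\<close>, so its first variation vanishes there: moving
  from \<open>v\<close> a little against \<open>N *v v\<close> would otherwise make the form
  negative.\<close>

lemma semidefinite_null_vector:
  fixes N :: "real ^ 'n ^ 'n"
  assumes sym: "transpose N = N" and pos: "\<And>w. w \<bullet> (N *v w) \<ge> 0" and v: "v \<bullet> (N *v v) = 0"
  shows "N *v v = 0"
proof (rule ccontr)
  assume "N *v v \<noteq> 0"
  define w where "w = N *v v"
  define a where "a = w \<bullet> w"
  define b where "b = w \<bullet> (N *v w)"
  have a: "a > 0" using \<open>N *v v \<noteq> 0\<close> by (simp add: a_def w_def)
  have b: "b \<ge> 0" unfolding b_def by (rule pos)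
  have vw: "v \<bullet> (N *v w) = a"
    using inner_transpose_matrix[of v N w] by (simp only: sym a_def flip: w_def)
  have quad: "0 \<le> 2 * t * a + t\<^sup>2 * b" for t
  proof -
    have "(v + t *\<^sub>R w) \<bullet> (N *v (v + t *\<^sub>R w)) = 2 * t * a + t\<^sup>2 * b"
      using v vw by (simp add: matrix_vector_right_distrib matrix_vector_mult_scaleR
          inner_add_left inner_add_right a_def b_def power2_eq_square distrib_left
          flip: w_def)
    then show ?thesis using pos by metis
  qed
  \<comment> \<open>The quadratic in \<open>t\<close> is smallest at \<open>- a / b\<close>; the
    denominator \<open>b + 1\<close> also covers \<open>b = 0\<close> and still gives a negative
    value.\<close>
  have "2 * (- a / (b + 1)) * a + (- a / (b + 1))\<^sup>2 * b = - (a\<^sup>2 * (b + 2)) / (b + 1)\<^sup>2"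
    using b by (simp add: field_simps power2_eq_square add_nonneg_eq_0_iff)
  also have "\<dots> < 0" using a b by (simp add: divide_neg_pos)
  finally show False using quad[of "- a / (b + 1)"] by simp
qed

lemma norm_mult_le_sphere:
  fixes M :: "real ^ 'n ^ 'm"
  assumes B: "\<And>u. norm u = 1 \<Longrightarrow> norm (M *v u) \<le> B"
  shows "norm (M *v w) \<le> B * norm w"
proof (cases "w = 0")
  case False
  have "norm (M *v w) = norm w * norm (M *v (w /\<^sub>R norm w))"
    using False by (simp add: matrix_vector_mult_scaleR)
  also have "\<dots> \<le> norm w * B"
    using False by (intro mult_left_mono B) auto
  finally show ?thesis by (simp add: mult.commute)
qed simp

text \<open>With \<mu> the claimed maximum, \<mu> times the identity minus the Gram matrix is
  positive semidefinite and its form vanishes at \<open>v\<close>, so \<open>v\<close> lies in its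
  kernel. Every eigenvalue is the Rayleigh quotient of its eigenvector and hence at most
  \<mu>.\<close>

lemma is_max_eigenvalue_gram:
  fixes M :: "real ^ 'n ^ 'm"
  assumes v: "norm v = 1" and max: "\<And>w. norm w = 1 \<Longrightarrow> norm (M *v w) \<le> norm (M *v v)"
  shows "is_max (eigenvalues (transpose M ** M)) ((norm (M *v v))\<^sup>2)"
proof -
  let ?\<mu> = "(norm (M *v v))\<^sup>2" and ?G = "transpose M ** M"
  have bound: "(norm (M *v w))\<^sup>2 \<le> ?\<mu> * (w \<bullet> w)" for w
  proof -
    have "(norm (M *v w))\<^sup>2 \<le> (norm (M *v v) * norm w)\<^sup>2"
      by (intro power_mono norm_mult_le_sphere max) auto
    then show ?thesis by (simp add: power_mult_distrib flip: power2_norm_eq_inner)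
  qed
  have eigen: "?G *v v = ?\<mu> *\<^sub>R v"
  proof -
    let ?N = "?\<mu> *\<^sub>R mat 1 - ?G :: real ^ 'n ^ 'n"
    have N: "?N *v w = ?\<mu> *\<^sub>R w - ?G *v w" for w
      by (simp only: matrix_vector_mult_diff_rdistrib scaleR_matrix_vector_assoc[symmetric]
          matrix_vector_mul_lid)
    have q: "w \<bullet> (?N *v w) = ?\<mu> * (w \<bullet> w) - (norm (M *v w))\<^sup>2" for w
      by (simp only: N inner_diff_right inner_scaleR_right inner_gram_matrix)
    have "transpose ?G = ?G" by (simp add: matrix_transpose_mul)
    then have "transpose ?N = ?N"
      by (simp add: transpose_def vec_eq_iff mat_def)
    moreover have "w \<bullet> (?N *v w) \<ge> 0" for w unfolding q using bound[of w] by linarith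
    moreover have "v \<bullet> (?N *v v) = 0" unfolding q using v by (simp add: norm_eq_1)
    ultimately have "?N *v v = 0" by (rule semidefinite_null_vector)
    then show ?thesis unfolding N by simp
  qed
  show ?thesis unfolding is_max_def
  proof (intro conjI ballI)
    show "?\<mu> \<in> eigenvalues ?G"
      using eigen v unfolding eigenvalues_def by (intro CollectI exI[of _ v]) auto
    fix y assume "y \<in> eigenvalues ?G"
    then obtain w where w: "w \<noteq> 0" "?G *v w = y *\<^sub>R w" by (auto simp: eigenvalues_def)
    have "y * (w \<bullet> w) = w \<bullet> (?G *v w)" unfolding w(2) by simp
    also have "\<dots> \<le> ?\<mu> * (w \<bullet> w)" unfolding inner_gram_matrix by (rule bound)
    finally show "y \<le> ?\<mu>" using w(1) by simp
  qed
qed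

text \<open>If \<open>v\<close> is an eigenvector of \<open>transpose P ** P\<close>, then
  \<open>P *v v\<close> is one of \<open>P ** transpose P\<close> for the same eigenvalue, and
  \<open>transpose Q ** Q\<close> is the inverse of that matrix.\<close>

lemma eigenvalue_gram_inverse:
  fixes P Q :: "real ^ 'n ^ 'n"
  assumes "\<kappa> \<in> eigenvalues (transpose P ** P)" and PQ: "P ** Q = mat 1" "Q ** P = mat 1"
  shows "1 / \<kappa> \<in> eigenvalues (transpose Q ** Q)" and "\<kappa> > 0"
proof -
  obtain v where v: "v \<noteq> 0" "(transpose P ** P) *v v = \<kappa> *\<^sub>R v"
    using assms(1) unfolding eigenvalues_def by blast
  have QP: "Q *v (P *v z) = z" "transpose Q *v (transpose P *v z) = z" for z
    by (simp_all only: matrix_vector_mul_assoc PQ transpose_mat matrix_vector_mul_lid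
        flip: matrix_transpose_mul)
  have Pv: "P *v v \<noteq> 0" using QP(1)[of v] v(1) by auto
  have "\<kappa> * (v \<bullet> v) = (norm (P *v v))\<^sup>2"
    using v(2) inner_gram_matrix[of v P] by simp
  then show \<kappa>: "\<kappa> > 0"
    using Pv v(1) by (metis inner_gt_zero_iff zero_less_mult_pos2 zero_less_norm_iff zero_less_power)
  have "transpose Q *v (transpose P *v (P *v v)) = \<kappa> *\<^sub>R (transpose Q *v v)"
    using v(2) by (simp only: matrix_vector_mult_scaleR flip: matrix_vector_mul_assoc)
  then have "\<kappa> *\<^sub>R (transpose Q *v (Q *v (P *v v))) = P *v v"
    unfolding QP by (rule sym)
  then have "transpose Q *v (Q *v (P *v v)) = (1 / \<kappa>) *\<^sub>R (P *v v)"
    using \<kappa> by (simp add: eq_vector_fraction_iff del: transpose_matrix_vector)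
  then show "1 / \<kappa> \<in> eigenvalues (transpose Q ** Q)"
    using Pv unfolding eigenvalues_def matrix_vector_mul_assoc[of _ Q] by blast
qed

text \<open>Taking reciprocals maps each of the two spectra into the other and reverses the order of
  positive numbers, so the largest eigenvalue goes to the smallest.\<close>

lemma is_min_eigenvalue_gram_inverse:
  fixes J K :: "real ^ 'n ^ 'n"
  assumes KJ: "K ** J = mat 1" and mu: "is_max (eigenvalues (transpose J ** J)) \<mu>"
  shows "is_min (eigenvalues (transpose K ** K)) (1 / \<mu>)"
proof -
  have JK: "J ** K = mat 1" using KJ matrix_left_right_inverse by blast
  have "\<mu> \<in> eigenvalues (transpose J ** J)" using mu by (simp add: is_max_def)
  note \<mu> = eigenvalue_gram_inverse[OF this JK KJ]
  moreover have "1 / \<mu> \<le> \<kappa>" if "\<kappa> \<in> eigenvalues (transpose K ** K)" for \<kappa>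
  proof -
    note \<kappa> = eigenvalue_gram_inverse[OF that KJ JK]
    then have "1 / \<kappa> \<le> \<mu>" using mu by (simp add: is_max_def)
    then show ?thesis using \<kappa>(2) \<mu>(2) by (simp add: field_simps)
  qed
  ultimately show ?thesis by (simp add: is_min_def)
qed

text \<open>Cauchy-Schwarz bounds the square of \<open>norm (transpose M *v w)\<close> by
  \<open>norm w\<close> times \<open>B\<close> times that same norm, which cancels when nonzero.
  Otherwise only \<open>0 \<le> B\<close> is needed, which a unit vector provides.\<close>

lemma norm_transpose_mult_le:
  fixes M :: "real ^ 'n ^ 'm"
  assumes B: "\<And>v. norm (M *v v) \<le> B * norm v"
  shows "norm (transpose M *v w) \<le> B * norm w"
proof (cases "transpose M *v w = 0")
  case True
  have "0 \<le> B * norm (SOME i. i \<in> (Basis :: (real ^ 'n) set))"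
    using B norm_ge_zero order_trans by blast
  then have "0 \<le> B"
    using some_in_eq[of "Basis :: (real ^ 'n) set"] by (simp add: norm_Basis)
  then show ?thesis unfolding True by simp
next
  case False
  let ?u = "transpose M *v w"
  have "(norm ?u)\<^sup>2 = w \<bullet> (M *v ?u)"
    by (simp only: inner_transpose_matrix power2_norm_eq_inner)
  also have "\<dots> \<le> norm w * norm (M *v ?u)" by (rule norm_cauchy_schwarz)
  also have "\<dots> \<le> norm w * (B * norm ?u)" by (intro mult_left_mono B) simp
  finally have "norm ?u * norm ?u \<le> (B * norm w) * norm ?u"
    by (simp only: power2_eq_square mult_ac)
  then show ?thesis using False by simp
qed

section \<open>Strong ellipticity of the transformed coefficients\<close>

theorem theorem4:
  fixes \<Omega> :: "(real ^ 'n) set"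
    and A :: "real ^ 'n \<Rightarrow> real ^ 'n ^ 'n"
    and \<Phi> :: "real ^ 'n \<Rightarrow> real ^ 'n"
    and c0 m :: real
  defines "J \<equiv> \<lambda>x. jacobian \<Phi> (at x within cball 0 1)"
    and "\<Psi> \<equiv> inv_into (cball 0 1) \<Phi>"
  defines "K \<equiv> \<lambda>s. jacobian \<Psi> (at s within closure \<Omega>)"
  defines "A' \<equiv> \<lambda>x. K (\<Phi> x) ** A (\<Phi> x) ** transpose (K (\<Phi> x))"
  assumes "CARD('n) \<ge> 2"
    and "open \<Omega>" and "connected \<Omega>" and "simply_connected \<Omega>" and "bounded \<Omega>"
    and "C2_boundary \<Omega>"
    and "\<And>s. s \<in> closure \<Omega> \<Longrightarrow> transpose (A s) = A s"
    and "\<And>i j. C2_closure \<Omega> (\<lambda>s. A s $ i $ j)"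
    and "c0 > 0"
    and "\<And>s \<xi>. s \<in> closure \<Omega> \<Longrightarrow> \<xi> \<bullet> (A s *v \<xi>) \<ge> c0 * (\<xi> \<bullet> \<xi>)"
    and "bij_betw \<Phi> (cball 0 1) (closure \<Omega>)"
    and "twice_differentiable_on \<Phi> (cball 0 1)"
    and "is_min ((\<lambda>x. \<bar>det (J x)\<bar>) ` cball 0 1) m" and "m > 0"
    and "\<And>x. x \<in> cball 0 1 \<Longrightarrow> det (J x) > 0"
  shows "\<exists>lmin lstar.
      (\<forall>x\<in>cball 0 1. is_min (eigenvalues (transpose (K (\<Phi> x)) ** K (\<Phi> x))) (lmin x)) \<and>
      (\<forall>x\<in>cball 0 1. \<exists>lmax. is_max (eigenvalues (transpose (J x) ** J x)) lmax \<and>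
                              lmin x = 1 / lmax) \<and>
      is_min (lmin ` cball 0 1) lstar \<and>
      c0 * lstar > 0 \<and>
      (\<forall>x\<in>cball 0 1. \<forall>\<xi>. \<xi> \<bullet> (A' x *v \<xi>) \<ge> c0 * lstar * (\<xi> \<bullet> \<xi>))"
proof -
  let ?B = "cball 0 1 :: (real ^ 'n) set" and ?S = "sphere 0 1 :: (real ^ 'n) set"
  note bij = assms(15) and diff = assms(16) and detpos = assms(19) and c0 = assms(13)
    and ell = assms(14)
  have KJ: "K (\<Phi> x) ** J x = mat 1" if x: "x \<in> ?B" for x
  proof -
    have "det (J x) \<noteq> 0" using detpos[OF x] by simp
    then show ?thesis
      using bij diff x jacobian_inv_into[of \<Phi> ?B x]
      by (simp add: J_def K_def \<Psi>_def bij_betw_def twice_differentiable_on_def)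
  qed
  have contJ: "continuous_on ?B J"
    using diff unfolding J_def twice_differentiable_on_def
    by (auto intro: differentiable_imp_continuous_on)
  have cont: "continuous_on (?B \<times> ?S) (\<lambda>z. norm (J (fst z) *v snd z))"
    unfolding matrix_vector_mult_def
    by (intro continuous_intros continuous_on_compose2[OF contJ]) auto
  have ne: "?S \<noteq> {}" by simp
  \<comment> \<open>Maximizing over pairs makes continuity of the largest eigenvalue in
    \<open>x\<close> unnecessary.\<close>
  have "compact (?B \<times> ?S)" "?B \<times> ?S \<noteq> {}" using ne by (auto simp: compact_Times)
  from continuous_attains_sup[OF this cont] obtain xm vm where
    xm: "xm \<in> ?B" and vm: "norm vm = 1" and
    glob: "\<And>x v. x \<in> ?B \<Longrightarrow> norm v = 1 \<Longrightarrow> norm (J x *v v) \<le> norm (J xm *v vm)"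
    by fastforce
  have "\<exists>v. norm v = 1 \<and> (\<forall>w. norm w = 1 \<longrightarrow> norm (J x *v w) \<le> norm (J x *v v))" for x
    using continuous_attains_sup[OF compact_sphere ne, of "\<lambda>v. norm (J x *v v)"]
    by (simp add: continuous_on_norm matrix_vector_mult_linear_continuous_on Bex_def Ball_def)
  then obtain v where v: "\<And>x. norm (v x) = 1"
    and vmax: "\<And>x w. norm w = 1 \<Longrightarrow> norm (J x *v w) \<le> norm (J x *v v x)" by metis
  define lmax where "lmax x = (norm (J x *v v x))\<^sup>2" for x
  have lmax: "is_max (eigenvalues (transpose (J x) ** J x)) (lmax x)" for x
    unfolding lmax_def using v vmax by (rule is_max_eigenvalue_gram)
  have lmax_pos: "lmax x > 0" if "x \<in> ?B" for x
  proof -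
    have "K (\<Phi> x) *v (J x *v v x) = v x" using KJ[OF that] by (simp add: matrix_vector_mul_assoc)
    then have "J x *v v x \<noteq> 0" using v[of x] by auto
    then show ?thesis by (simp add: lmax_def)
  qed
  \<comment> \<open>The vectors \<open>vm\<close> and \<open>v xm\<close> may differ, so two
    comparisons are chained: \<open>glob\<close> passes from \<open>x\<close> to \<open>xm\<close>,
    and \<open>vmax\<close> from \<open>vm\<close> to \<open>v xm\<close>.\<close>
  have lmax_le: "lmax x \<le> lmax xm" if "x \<in> ?B" for x
    using order_trans[OF glob[OF that v[of x]] vmax[OF vm, of xm]] unfolding lmax_def
    by (intro power_mono) auto
  have J_bound: "norm (J x *v w) \<le> norm (J x *v v x) * norm w" for x w
    by (intro norm_mult_le_sphere vmax)
  have ellip: "\<xi> \<bullet> (A' x *v \<xi>) \<ge> c0 * (1 / lmax xm) * (\<xi> \<bullet> \<xi>)" if x: "x \<in> ?B" for x \<xi>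
  proof -
    \<comment> \<open>This substitution turns the form of \<open>A' x\<close> at \<xi> into that of
      \<open>A (\<Phi> x)\<close> at \<eta>. Since \<open>transpose (J x)\<close> recovers \<xi>
      from \<eta>, the bound on \<open>J x\<close> bounds \<eta> from below.\<close>
    define \<eta> where "\<eta> = transpose (K (\<Phi> x)) *v \<xi>"
    have \<xi>: "transpose (J x) *v \<eta> = \<xi>"
      using KJ[OF x] by (simp only: \<eta>_def matrix_vector_mul_assoc flip: matrix_transpose_mul) simp
    have "norm \<xi> \<le> norm (J x *v v x) * norm \<eta>"
      using norm_transpose_mult_le[OF J_bound, of x \<eta>] by (simp only: \<xi>)
    then have "(norm \<xi>)\<^sup>2 \<le> (norm (J x *v v x) * norm \<eta>)\<^sup>2"
      by (intro power_mono) auto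
    then have "\<xi> \<bullet> \<xi> \<le> lmax x * (\<eta> \<bullet> \<eta>)"
      by (simp add: lmax_def power_mult_distrib flip: power2_norm_eq_inner)
    also have "\<dots> \<le> lmax xm * (\<eta> \<bullet> \<eta>)" using lmax_le[OF x] by (intro mult_right_mono) auto
    finally have "(\<xi> \<bullet> \<xi>) / lmax xm \<le> \<eta> \<bullet> \<eta>"
      using lmax_pos[OF xm] by (simp add: field_simps)
    then have "c0 * ((\<xi> \<bullet> \<xi>) / lmax xm) \<le> c0 * (\<eta> \<bullet> \<eta>)"
      using c0 by (intro mult_left_mono) auto
    also have "\<dots> \<le> \<eta> \<bullet> (A (\<Phi> x) *v \<eta>)"
      using bij x by (intro ell) (auto simp: bij_betw_def)
    also have "\<dots> = \<xi> \<bullet> (A' x *v \<xi>)"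
    proof -
      have "\<xi> \<bullet> (A' x *v \<xi>) = \<xi> \<bullet> (K (\<Phi> x) *v (A (\<Phi> x) *v \<eta>))"
        by (simp only: A'_def \<eta>_def matrix_vector_mul_assoc matrix_mul_assoc)
      then show ?thesis by (simp only: inner_transpose_matrix[of \<xi>] flip: \<eta>_def)
    qed
    finally show ?thesis by simp
  qed
  show ?thesis
  \<comment> \<open>The witnesses are \<open>1 / lmax x\<close> for \<open>lmin x\<close> and
    \<open>1 / lmax xm\<close> for \<open>lstar\<close>: the reciprocal is smallest where
    \<open>lmax\<close> is largest.\<close>
  proof (intro exI conjI ballI allI)
    show "is_min (eigenvalues (transpose (K (\<Phi> x)) ** K (\<Phi> x))) (1 / lmax x)" if "x \<in> ?B" for x
      using KJ[OF that] lmax by (rule is_min_eigenvalue_gram_inverse)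
    show "is_max (eigenvalues (transpose (J x) ** J x)) (lmax x)" for x by (rule lmax)
    show "is_min ((\<lambda>x. 1 / lmax x) ` ?B) (1 / lmax xm)"
      using xm lmax_pos lmax_le by (auto simp: is_min_def intro!: frac_le)
    show "c0 * (1 / lmax xm) > 0" using c0 lmax_pos[OF xm] by simp
  qed (use ellip in auto)
qed

end
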